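(* If $f\in\mathrm{BMO}_{\mathrm{na}}$ and $\|f\|_G=1$, then $f$ is an extreme point of $\mathrm{ball}(\mathrm{BMO})$.
   Context: $\mathbb D=\{z\in\mathbb C:|z|<1\}$, $\mathbb T=\partial\mathbb D$, $m$ is normalized arc length measure on $\mathbb T$, $L^p=L^p(\mathbb T,m)$ (complex-valued functions). For $f\in L^1$, the Poisson integral is $\mathcal Pf(z)=\int_{\mathbb T}f(\zeta)\frac{1-|z|^2}{|\zeta-z|^2}\,dm(\zeta)$, $z\in\mathbb D$. For $f\in L^2$ put $\Phi_f(z)=\mathcal P(|f|^2)(z)-|\mathcal Pf(z)|^2$, $z\in\mathbb D$, and $\|f\|_G=\sup_{z\in\mathbb D}\Phi_f(z)^{1/2}$ (the Garsia norm). $\mathrm{BMO}$ is the set of $f\in L^2$ with $\|f\|_G<\infty$. $\mathrm{BMO}_{\mathrm{na}}$ is the set of $f\in\mathrm{BMO}$ for which there is a point $z_0\in\mathbb D$ with $\|f\|_G^2=\Phi_f(z_0)$. The functions annihilated by $\|\cdot\|_G$ are the constants, and $\mathrm{BMO}$ is regarded here as a quotient space modulo constants, normed by $\|\cdot\|_G$; thus an element $f$ of $\mathrm{BMO}$ is understood as the coset $f+\mathbb C$. For a normed space $X$, $\mathrm{ball}(X)=\{x\in X:\|x\|\le1\}$; an element $x\in\mathrm{ball}(X)$ is an extreme point of $\mathrm{ball}(X)$ if it is not of the form $x=\frac12(u+v)$ with two distinct points $u,v\in\mathrm{ball}(X)$. *)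

theory Defs
  imports "HOL-Complex_Analysis.Complex_Analysis" "HOL-Probability.Probability"
begin

(* Normalized arc length on the unit circle: the push-forward of Lebesgue measure on [0,1]
   under t |-> exp(2 pi i t), completed so that all Lebesgue measurable functions are covered. *)
definition circle_measure :: "complex measure" where
  "circle_measure =
     completion (distr (restrict_space lborel {0..1}) (restrict_space borel (sphere 0 1))
       (\<lambda>t::real. cis (2 * pi * t)))"

definition L2_circle :: "(complex \<Rightarrow> complex) set" where
  "L2_circle = {f \<in> borel_measurable circle_measure.
     integrable circle_measure (\<lambda>\<zeta>. (norm (f \<zeta>))\<^sup>2)}"

definition poisson_kernel :: "complex \<Rightarrow> complex \<Rightarrow> real" where
  "poisson_kernel z \<zeta> = (1 - (norm z)\<^sup>2) / (norm (\<zeta> - z))\<^sup>2"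

(* Polymorphic, because it is applied both to f (complex) and to |f|^2 (real). *)
definition poisson_integral ::
    "(complex \<Rightarrow> 'a::{banach, second_countable_topology}) \<Rightarrow> complex \<Rightarrow> 'a" where
  "poisson_integral f z = (\<integral>\<zeta>. poisson_kernel z \<zeta> *\<^sub>R f \<zeta> \<partial>circle_measure)"

definition garsia_Phi :: "(complex \<Rightarrow> complex) \<Rightarrow> complex \<Rightarrow> real" where
  "garsia_Phi f z =
     poisson_integral (\<lambda>\<zeta>. (norm (f \<zeta>))\<^sup>2) z - (norm (poisson_integral f z))\<^sup>2"

definition garsia_norm :: "(complex \<Rightarrow> complex) \<Rightarrow> ereal" where
  "garsia_norm f = (SUP z\<in>ball 0 1. ereal (sqrt (garsia_Phi f z)))"

definition BMO_fun :: "(complex \<Rightarrow> complex) set" where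
  "BMO_fun = {f \<in> L2_circle. garsia_norm f < \<infinity>}"

definition BMO_na :: "(complex \<Rightarrow> complex) set" where
  "BMO_na = {f \<in> BMO_fun. \<exists>z0\<in>ball 0 1. (garsia_norm f)\<^sup>2 = ereal (garsia_Phi f z0)}"

lemma circle_param_measurable:
  "(\<lambda>t::real. cis (2 * pi * t)) \<in>
     restrict_space lborel {0..1} \<rightarrow>\<^sub>M restrict_space borel (sphere 0 1)"
proof (rule measurable_restrict_space2)
  have "continuous_on UNIV (\<lambda>t::real. cis (2 * pi * t))"
    by (intro continuous_intros)
  then have "(\<lambda>t::real. cis (2 * pi * t)) \<in> borel_measurable lborel"
    by (simp add: borel_measurable_continuous_onI)
  then show "(\<lambda>t::real. cis (2 * pi * t)) \<in> restrict_space lborel {0..1} \<rightarrow>\<^sub>M borel"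
    by (rule measurable_restrict_space1)
qed auto

lemma space_circle_measure [simp]: "space circle_measure = sphere 0 1"
  by (simp add: circle_measure_def space_restrict_space)

lemma prob_space_circle_measure: "prob_space circle_measure"
proof -
  have "prob_space (restrict_space lborel {0..1::real})"
    by (rule prob_spaceI) (simp add: emeasure_restrict_space space_restrict_space)
  then have "prob_space (distr (restrict_space lborel {0..1}) (restrict_space borel (sphere 0 1))
       (\<lambda>t::real. cis (2 * pi * t)))"
    by (rule prob_space.prob_space_distr) (rule circle_param_measurable)
  then show ?thesis
    unfolding circle_measure_def by (rule prob_space.prob_space_completion)
qed

interpretation circle: prob_space circle_measure
  by (rule prob_space_circle_measure)

lemma circle_measurable_continuous:
  assumes "continuous_on (sphere 0 1) g"
  shows "g \<in> borel_measurable circle_measure"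
proof -
  have "g \<in> borel_measurable (restrict_space borel (sphere 0 1))"
    using assms by (rule borel_measurable_continuous_on_restrict)
  then show ?thesis
    unfolding circle_measure_def by (intro measurable_completion) simp
qed

lemma poisson_kernel_continuous:
  assumes "z \<in> ball 0 1"
  shows "continuous_on (sphere 0 1) (poisson_kernel z)"
  unfolding poisson_kernel_def
  using assms by (intro continuous_intros) auto

lemma poisson_kernel_measurable:
  "z \<in> ball 0 1 \<Longrightarrow> poisson_kernel z \<in> borel_measurable circle_measure"
  by (intro circle_measurable_continuous poisson_kernel_continuous)

lemma poisson_kernel_nonneg: "z \<in> ball 0 1 \<Longrightarrow> 0 \<le> poisson_kernel z \<zeta>"
  by (auto simp: poisson_kernel_def power_le_one)

lemma poisson_kernel_bound:
  assumes "z \<in> ball 0 1" "\<zeta> \<in> sphere 0 1"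
  shows "poisson_kernel z \<zeta> \<le> 1 / (1 - norm z)\<^sup>2"
proof -
  have *: "1 - norm z \<le> norm (\<zeta> - z)"
    using norm_triangle_ineq2[of \<zeta> z] assms by simp
  have "poisson_kernel z \<zeta> \<le> 1 / (norm (\<zeta> - z))\<^sup>2"
    unfolding poisson_kernel_def by (intro divide_right_mono) auto
  also have "\<dots> \<le> 1 / (1 - norm z)\<^sup>2"
    using * assms by (intro divide_left_mono power_mono mult_pos_pos) (auto simp: zero_less_power2)
  finally show ?thesis .
qed

lemma poisson_integrable:
  fixes f :: "complex \<Rightarrow> 'a::{banach, second_countable_topology}"
  assumes z: "z \<in> ball 0 1" and f: "integrable circle_measure f"
  shows "integrable circle_measure (\<lambda>\<zeta>. poisson_kernel z \<zeta> *\<^sub>R f \<zeta>)"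
proof (rule Bochner_Integration.integrable_bound)
  show "integrable circle_measure (\<lambda>\<zeta>. (1 / (1 - norm z)\<^sup>2) *\<^sub>R f \<zeta>)"
    using f by simp
  show "(\<lambda>\<zeta>. poisson_kernel z \<zeta> *\<^sub>R f \<zeta>) \<in> borel_measurable circle_measure"
    using poisson_kernel_measurable[OF z] f by measurable
  show "AE \<zeta> in circle_measure. norm (poisson_kernel z \<zeta> *\<^sub>R f \<zeta>)
          \<le> norm ((1 / (1 - norm z)\<^sup>2) *\<^sub>R f \<zeta>)"
  proof (rule AE_I2)
    fix \<zeta> assume "\<zeta> \<in> space circle_measure"
    then have "poisson_kernel z \<zeta> \<le> 1 / (1 - norm z)\<^sup>2"
      using poisson_kernel_bound[OF z] by simp
    then have "poisson_kernel z \<zeta> * norm (f \<zeta>) \<le> 1 / (1 - norm z)\<^sup>2 * norm (f \<zeta>)"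
      by (rule mult_right_mono) simp
    then show "norm (poisson_kernel z \<zeta> *\<^sub>R f \<zeta>) \<le> norm ((1 / (1 - norm z)\<^sup>2) *\<^sub>R f \<zeta>)"
      using poisson_kernel_nonneg[OF z, of \<zeta>] by simp
  qed
qed

lemma integral_circle_measure:
  fixes g :: "complex \<Rightarrow> real"
  assumes g: "continuous_on (sphere 0 1) g"
    and I: "((\<lambda>t. g (cis (2 * pi * t))) has_integral I) {0..1}"
  shows "integral\<^sup>L circle_measure g = I"
proof -
  have gm: "g \<in> borel_measurable (restrict_space borel (sphere 0 1))"
    using g by (rule borel_measurable_continuous_on_restrict)
  have c: "continuous_on {0..1} (\<lambda>t. g (cis (2 * pi * t)))"
    by (rule continuous_on_compose2[OF g]) (auto intro!: continuous_intros)
  have "integral\<^sup>L circle_measure g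
      = (\<integral>t. g (cis (2 * pi * t)) \<partial>restrict_space lborel {0..1})"
    unfolding circle_measure_def
    using gm circle_param_measurable by (simp add: integral_completion integral_distr)
  also have "\<dots> = (LINT t:{0..1}|lborel. g (cis (2 * pi * t)))"
    by (simp add: integral_restrict_space set_lebesgue_integral_def)
  also have "\<dots> = integral {0..1} (\<lambda>t. g (cis (2 * pi * t)))"
    by (rule set_borel_integral_eq_integral) (rule borel_integrable_atLeastAtMost'[OF c])
  also have "\<dots> = I"
    using I by (rule integral_unique)
  finally show ?thesis .
qed

lemma poisson_kernel_eq_Re:
  assumes z: "z \<in> ball 0 1" and w: "norm w = 1"
  shows "poisson_kernel z w = Re ((1 + cnj z * w) / (1 - cnj z * w))"
proof -
  have ww: "w * cnj w = 1"
    using w by (simp add: complex_norm_square[symmetric])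
  have "norm (w - z) = norm (cnj w * (w - z))"
    using w by (simp add: norm_mult)
  also have "cnj w * (w - z) = cnj (1 - cnj z * w)"
    using ww by (simp add: algebra_simps)
  finally have n: "norm (w - z) = norm (1 - cnj z * w)"
    by (simp only: complex_mod_cnj)
  have "Re ((1 + cnj z * w) / (1 - cnj z * w))
      = Re ((1 + cnj z * w) * cnj (1 - cnj z * w)) / (norm (1 - cnj z * w))\<^sup>2"
    by (simp add: complex_div_cnj[of _ "1 - cnj z * w"] Re_divide_of_real flip: of_real_power)
  also have "Re ((1 + cnj z * w) * cnj (1 - cnj z * w)) = 1 - (norm (cnj z * w))\<^sup>2"
    unfolding cmod_power2 by (simp add: algebra_simps power2_eq_square)
  also have "norm (cnj z * w) = norm z"
    using w by (simp add: norm_mult)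
  finally show ?thesis
    by (simp add: poisson_kernel_def n)
qed

lemma integral_poisson_kernel:
  assumes z: "z \<in> ball 0 1"
  shows "integral\<^sup>L circle_measure (poisson_kernel z) = 1"
proof (rule integral_circle_measure[OF poisson_kernel_continuous[OF z]])
  define h where "h = (\<lambda>w. (1 + cnj z * w) / (1 - cnj z * w))"
  have nz: "1 - cnj z * w \<noteq> 0" if "w \<in> cball 0 1" for w
  proof
    assume "1 - cnj z * w = 0"
    then have "norm (cnj z * w) = 1" by simp
    moreover have "norm z * norm w \<le> norm z * 1"
      using that by (intro mult_left_mono) auto
    ultimately show False using z by (simp add: norm_mult)
  qed
  have "h holomorphic_on cball 0 1"
    unfolding h_def using nz by (intro holomorphic_intros) auto
  then have "((\<lambda>u. h u / (u - 0)) has_contour_integral (2 * of_real pi * \<i> * h 0)) (circlepath 0 1)"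
    by (rule Cauchy_integral_circlepath_simple) simp
  then have "((\<lambda>t. h (circlepath 0 1 t) / circlepath 0 1 t
      * vector_derivative (circlepath 0 1) (at t)) has_integral (2 * of_real pi * \<i>)) {0..1}"
    by (simp add: has_contour_integral h_def)
  then have "((\<lambda>t. (2 * of_real pi * \<i>) * h (cis (2 * pi * t))) has_integral (2 * of_real pi * \<i>)) {0..1}"
    by (rule has_integral_eq[rotated], unfold vector_derivative_circlepath)
       (simp add: circlepath cis_conv_exp mult_ac)
  then have "((\<lambda>t. inverse (2 * of_real pi * \<i>) * ((2 * of_real pi * \<i>) * h (cis (2 * pi * t))))
      has_integral (inverse (2 * of_real pi * \<i>) * (2 * of_real pi * \<i>))) {0..1}"
    by (rule has_integral_mult_right)
  then have "((\<lambda>t. h (cis (2 * pi * t))) has_integral 1) {0..1}"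
    by (simp add: field_simps)
  then have "((\<lambda>t. Re (h (cis (2 * pi * t)))) has_integral Re 1) {0..1}"
    using has_integral_linear[OF _ bounded_linear_Re] by (force simp: o_def)
  then show "((\<lambda>t. poisson_kernel z (cis (2 * pi * t))) has_integral 1) {0..1}"
    using poisson_kernel_eq_Re[OF z] by (simp add: h_def)
qed

lemma poisson_integral_const:
  fixes c :: "'a::{banach, second_countable_topology}"
  assumes "z \<in> ball 0 1"
  shows "poisson_integral (\<lambda>_. c) z = c"
proof -
  have "integrable circle_measure (poisson_kernel z)"
    using poisson_integrable[OF assms, of "\<lambda>_. 1::real"] by simp
  then show ?thesis
    by (simp add: poisson_integral_def integral_poisson_kernel[OF assms])
qed

lemma poisson_integral_add:
  fixes f g :: "complex \<Rightarrow> 'a::{banach, second_countable_topology}"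
  assumes "z \<in> ball 0 1" "integrable circle_measure f" "integrable circle_measure g"
  shows "poisson_integral (\<lambda>\<zeta>. f \<zeta> + g \<zeta>) z = poisson_integral f z + poisson_integral g z"
  using poisson_integrable[OF assms(1,2)] poisson_integrable[OF assms(1,3)]
  by (simp add: poisson_integral_def scaleR_add_right)

lemma poisson_integral_scaleR:
  fixes f :: "complex \<Rightarrow> 'a::{banach, second_countable_topology}"
  shows "poisson_integral (\<lambda>\<zeta>. r *\<^sub>R f \<zeta>) z = r *\<^sub>R poisson_integral f z"
  unfolding poisson_integral_def
  by (subst integral_scaleR_right[symmetric]) (simp add: mult.commute)

lemma poisson_integral_mono:
  fixes f g :: "complex \<Rightarrow> real"
  assumes "z \<in> ball 0 1" "integrable circle_measure f" "integrable circle_measure g"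
    and "\<And>\<zeta>. f \<zeta> \<le> g \<zeta>"
  shows "poisson_integral f z \<le> poisson_integral g z"
  unfolding poisson_integral_def
  using poisson_integrable[OF assms(1,2)] poisson_integrable[OF assms(1,3)]
  by (intro integral_mono) (auto intro!: mult_left_mono assms poisson_kernel_nonneg)

lemma L2_circle_measurable: "f \<in> L2_circle \<Longrightarrow> f \<in> borel_measurable circle_measure"
  and L2_circle_square: "f \<in> L2_circle \<Longrightarrow> integrable circle_measure (\<lambda>\<zeta>. (norm (f \<zeta>))\<^sup>2)"
  by (auto simp: L2_circle_def)

lemma L2_circle_integrable:
  assumes "f \<in> L2_circle"
  shows "integrable circle_measure f"
proof (rule Bochner_Integration.integrable_bound)
  show "integrable circle_measure (\<lambda>\<zeta>. 1 + (norm (f \<zeta>))\<^sup>2)"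
    using L2_circle_square[OF assms] by simp
  show "f \<in> borel_measurable circle_measure"
    using assms by (rule L2_circle_measurable)
  have "x \<le> 1 + x\<^sup>2" for x :: real
    using zero_le_power2[of "x - 1"] zero_le_power2[of x]
    unfolding power2_diff power_one mult_1_right by linarith
  then show "AE \<zeta> in circle_measure. norm (f \<zeta>) \<le> norm (1 + (norm (f \<zeta>))\<^sup>2)"
    by simp
qed

lemma norm_square_add_le:
  fixes a b :: "'a::real_inner" and t :: real
  assumes "0 < t"
  shows "(norm (a + b))\<^sup>2 \<le> (1 + t) * (norm a)\<^sup>2 + (1 + 1 / t) * (norm b)\<^sup>2"
proof -
  have "0 \<le> (norm (t *\<^sub>R a - b))\<^sup>2 / t"
    using assms by simp
  also have "(norm (t *\<^sub>R a - b))\<^sup>2 / t = t * (norm a)\<^sup>2 - 2 * (a \<bullet> b) + (norm b)\<^sup>2 / t"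
    using assms unfolding power2_norm_eq_inner
    by (simp add: inner_diff_left inner_diff_right inner_commute field_simps)
  finally show ?thesis
    unfolding power2_norm_eq_inner
    by (simp add: inner_add_left inner_add_right inner_commute algebra_simps)
qed

lemma L2_circle_add:
  assumes f: "f \<in> L2_circle" and g: "g \<in> L2_circle"
  shows "(\<lambda>\<zeta>. f \<zeta> + g \<zeta>) \<in> L2_circle"
proof -
  have m: "(\<lambda>\<zeta>. f \<zeta> + g \<zeta>) \<in> borel_measurable circle_measure"
    using f g by (intro borel_measurable_add L2_circle_measurable)
  have "integrable circle_measure (\<lambda>\<zeta>. (norm (f \<zeta> + g \<zeta>))\<^sup>2)"
  proof (rule Bochner_Integration.integrable_bound)
    show "integrable circle_measure (\<lambda>\<zeta>. 2 * (norm (f \<zeta>))\<^sup>2 + 2 * (norm (g \<zeta>))\<^sup>2)"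
      using f g by (simp add: L2_circle_square)
    show "(\<lambda>\<zeta>. (norm (f \<zeta> + g \<zeta>))\<^sup>2) \<in> borel_measurable circle_measure"
      using m by measurable
    show "AE \<zeta> in circle_measure. norm ((norm (f \<zeta> + g \<zeta>))\<^sup>2)
        \<le> norm (2 * (norm (f \<zeta>))\<^sup>2 + 2 * (norm (g \<zeta>))\<^sup>2)"
    proof (rule AE_I2)
      fix \<zeta>
      show "norm ((norm (f \<zeta> + g \<zeta>))\<^sup>2) \<le> norm (2 * (norm (f \<zeta>))\<^sup>2 + 2 * (norm (g \<zeta>))\<^sup>2)"
        using norm_square_add_le[of 1 "f \<zeta>" "g \<zeta>"] by simp
    qed
  qed
  with m show ?thesis by (simp add: L2_circle_def)
qed

lemma L2_circle_scaleR:
  assumes "f \<in> L2_circle"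
  shows "(\<lambda>\<zeta>. r *\<^sub>R f \<zeta>) \<in> L2_circle"
proof -
  have "(\<lambda>\<zeta>. r *\<^sub>R f \<zeta>) \<in> borel_measurable circle_measure"
    using L2_circle_measurable[OF assms] by measurable
  then show ?thesis
    using L2_circle_square[OF assms] by (simp add: L2_circle_def power_mult_distrib)
qed

lemma L2_circle_const: "(\<lambda>_. c) \<in> L2_circle"
  by (simp add: L2_circle_def)

lemma poisson_square_shift:
  assumes z: "z \<in> ball 0 1" and f: "f \<in> L2_circle"
  shows "poisson_integral (\<lambda>\<zeta>. (norm (f \<zeta> - c))\<^sup>2) z
    = garsia_Phi f z + (norm (poisson_integral f z - c))\<^sup>2"
proof -
  note fi = L2_circle_integrable[OF f] and f2 = L2_circle_square[OF f]
  have lin: "integrable circle_measure (\<lambda>\<zeta>. f \<zeta> \<bullet> c)"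
    using fi by (rule integrable_inner_left)
  have inn: "poisson_integral (\<lambda>\<zeta>. f \<zeta> \<bullet> c) z = poisson_integral f z \<bullet> c"
    unfolding poisson_integral_def
    using integral_inner_left[OF poisson_integrable[OF z fi], of c] by simp
  have eq: "(\<lambda>\<zeta>. (norm (f \<zeta> - c))\<^sup>2)
      = (\<lambda>\<zeta>. (norm (f \<zeta>))\<^sup>2 + ((-2) *\<^sub>R (f \<zeta> \<bullet> c) + (norm c)\<^sup>2))"
    by (simp add: fun_eq_iff power2_norm_eq_inner inner_diff_left inner_diff_right inner_commute)
  have "poisson_integral (\<lambda>\<zeta>. (norm (f \<zeta> - c))\<^sup>2) z = poisson_integral (\<lambda>\<zeta>. (norm (f \<zeta>))\<^sup>2) z
      + ((-2) *\<^sub>R poisson_integral (\<lambda>\<zeta>. f \<zeta> \<bullet> c) z + (norm c)\<^sup>2)"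
    using z f2 lin unfolding eq
    by (subst poisson_integral_add, simp, simp, simp)
       (subst poisson_integral_add, simp, simp, simp,
        subst poisson_integral_scaleR, subst poisson_integral_const, simp, simp)
  then have "poisson_integral (\<lambda>\<zeta>. (norm (f \<zeta> - c))\<^sup>2) z
      = poisson_integral (\<lambda>\<zeta>. (norm (f \<zeta>))\<^sup>2) z - 2 * (poisson_integral f z \<bullet> c) + (norm c)\<^sup>2"
    unfolding inn by simp
  moreover have "(norm (poisson_integral f z - c))\<^sup>2
      = (norm (poisson_integral f z))\<^sup>2 - 2 * (poisson_integral f z \<bullet> c) + (norm c)\<^sup>2"
    by (simp add: power2_norm_eq_inner inner_diff_left inner_diff_right inner_commute)
  ultimately show ?thesis
    by (simp add: garsia_Phi_def)
qed

lemma garsia_Phi_alt: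
  assumes "z \<in> ball 0 1" "f \<in> L2_circle"
  shows "garsia_Phi f z = poisson_integral (\<lambda>\<zeta>. (norm (f \<zeta> - poisson_integral f z))\<^sup>2) z"
  using poisson_square_shift[OF assms] by simp

lemma garsia_Phi_nonneg:
  assumes "z \<in> ball 0 1" "f \<in> L2_circle"
  shows "0 \<le> garsia_Phi f z"
  unfolding garsia_Phi_alt[OF assms] unfolding poisson_integral_def
  using poisson_kernel_nonneg[OF assms(1)] by (intro Bochner_Integration.integral_nonneg) simp

lemma garsia_Phi_scaleR: "garsia_Phi (\<lambda>\<zeta>. r *\<^sub>R f \<zeta>) z = r\<^sup>2 * garsia_Phi f z"
  using poisson_integral_scaleR[of "r\<^sup>2" "\<lambda>\<zeta>. (norm (f \<zeta>))\<^sup>2" z]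
    poisson_integral_scaleR[of r f z]
  by (simp add: garsia_Phi_def power_mult_distrib right_diff_distrib)

lemma poisson_integral_cong_AE:
  fixes f g :: "complex \<Rightarrow> 'a::{banach, second_countable_topology}"
  assumes "z \<in> ball 0 1" "f \<in> borel_measurable circle_measure"
    "g \<in> borel_measurable circle_measure" "AE \<zeta> in circle_measure. f \<zeta> = g \<zeta>"
  shows "poisson_integral f z = poisson_integral g z"
  unfolding poisson_integral_def
proof (rule integral_cong_AE)
  note [measurable] = poisson_kernel_measurable[OF assms(1)] assms(2,3)
  show "(\<lambda>\<zeta>. poisson_kernel z \<zeta> *\<^sub>R f \<zeta>) \<in> borel_measurable circle_measure" by measurable
  show "(\<lambda>\<zeta>. poisson_kernel z \<zeta> *\<^sub>R g \<zeta>) \<in> borel_measurable circle_measure" by measurable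
  show "AE \<zeta> in circle_measure. poisson_kernel z \<zeta> *\<^sub>R f \<zeta> = poisson_kernel z \<zeta> *\<^sub>R g \<zeta>"
    using assms(4) by eventually_elim simp
qed

lemma garsia_Phi_cong:
  assumes z: "z \<in> ball 0 1" and f: "f \<in> L2_circle" and g: "g \<in> L2_circle"
    and eq: "AE \<zeta> in circle_measure. f \<zeta> = g \<zeta> + c"
  shows "garsia_Phi f z = garsia_Phi g z"
proof -
  note [measurable] = L2_circle_measurable[OF f] L2_circle_measurable[OF g]
  have "poisson_integral f z = poisson_integral (\<lambda>\<zeta>. g \<zeta> + c) z"
    using eq by (intro poisson_integral_cong_AE[OF z]) auto
  also have "\<dots> = poisson_integral g z + c"
    using L2_circle_integrable[OF g] z
    by (subst poisson_integral_add) (simp_all add: poisson_integral_const)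
  finally have p: "poisson_integral f z = poisson_integral g z + c" .
  show ?thesis
    unfolding garsia_Phi_alt[OF z f] garsia_Phi_alt[OF z g]
    using eq by (intro poisson_integral_cong_AE[OF z]) (auto simp: p)
qed

lemma sqrt_triangle_aux:
  fixes A B C :: real
  assumes "0 \<le> A" "0 \<le> B" and C: "\<And>t. 0 < t \<Longrightarrow> C \<le> (1 + t) * A + (1 + 1 / t) * B"
  shows "sqrt C \<le> sqrt A + sqrt B"
proof (rule field_le_epsilon)
  fix e :: real assume e: "0 < e"
  define a where "a = sqrt A + e / 2"
  define b where "b = sqrt B + e / 2"
  have ab: "0 < a" "0 < b" and le: "A \<le> a\<^sup>2" "B \<le> b\<^sup>2"
    using assms e by (auto simp: a_def b_def power2_sum add_nonneg_pos)
  have "C \<le> (1 + b / a) * A + (1 + 1 / (b / a)) * B"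
    using ab by (intro C) simp
  also have "\<dots> \<le> (1 + b / a) * a\<^sup>2 + (1 + 1 / (b / a)) * b\<^sup>2"
    using ab le by (intro add_mono mult_left_mono) auto
  also have "\<dots> = (a + b)\<^sup>2"
    using ab by (simp add: field_simps power2_eq_square)
  finally have "sqrt C \<le> a + b"
    using ab by (intro real_le_lsqrt) auto
  then show "sqrt C \<le> sqrt A + sqrt B + e"
    by (simp add: a_def b_def)
qed

lemma garsia_Phi_triangle:
  assumes z: "z \<in> ball 0 1" and f: "f \<in> L2_circle" and g: "g \<in> L2_circle"
  shows "sqrt (garsia_Phi (\<lambda>\<zeta>. f \<zeta> + g \<zeta>) z) \<le> sqrt (garsia_Phi f z) + sqrt (garsia_Phi g z)"
proof (rule sqrt_triangle_aux)
  show "0 \<le> garsia_Phi f z" "0 \<le> garsia_Phi g z"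
    using assms by (auto intro: garsia_Phi_nonneg)
  fix t :: real assume t: "0 < t"
  define u where "u = (\<lambda>\<zeta>. f \<zeta> + (- poisson_integral f z))"
  define v where "v = (\<lambda>\<zeta>. g \<zeta> + (- poisson_integral g z))"
  have u: "u \<in> L2_circle" and v: "v \<in> L2_circle"
    unfolding u_def v_def by (intro L2_circle_add L2_circle_const f g)+
  have iu: "integrable circle_measure (\<lambda>\<zeta>. (1 + t) *\<^sub>R (norm (u \<zeta>))\<^sup>2)"
    and iv: "integrable circle_measure (\<lambda>\<zeta>. (1 + 1 / t) *\<^sub>R (norm (v \<zeta>))\<^sup>2)"
    using L2_circle_square[OF u] L2_circle_square[OF v] by simp_all
  have p: "poisson_integral (\<lambda>\<zeta>. f \<zeta> + g \<zeta>) z = poisson_integral f z + poisson_integral g z"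
    using z f g by (intro poisson_integral_add L2_circle_integrable)
  have "garsia_Phi (\<lambda>\<zeta>. f \<zeta> + g \<zeta>) z = poisson_integral (\<lambda>\<zeta>. (norm (u \<zeta> + v \<zeta>))\<^sup>2) z"
    unfolding garsia_Phi_alt[OF z L2_circle_add[OF f g]] p u_def v_def
    by (simp add: algebra_simps)
  also have "\<dots> \<le> poisson_integral (\<lambda>\<zeta>. (1 + t) *\<^sub>R (norm (u \<zeta>))\<^sup>2
      + (1 + 1 / t) *\<^sub>R (norm (v \<zeta>))\<^sup>2) z"
  proof (rule poisson_integral_mono[OF z])
    show "integrable circle_measure (\<lambda>\<zeta>. (norm (u \<zeta> + v \<zeta>))\<^sup>2)"
      by (rule L2_circle_square[OF L2_circle_add[OF u v]])
    show "integrable circle_measure (\<lambda>\<zeta>. (1 + t) *\<^sub>R (norm (u \<zeta>))\<^sup>2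
      + (1 + 1 / t) *\<^sub>R (norm (v \<zeta>))\<^sup>2)"
      using iu iv by (rule Bochner_Integration.integrable_add)
    show "(norm (u \<zeta> + v \<zeta>))\<^sup>2 \<le> (1 + t) *\<^sub>R (norm (u \<zeta>))\<^sup>2 + (1 + 1 / t) *\<^sub>R (norm (v \<zeta>))\<^sup>2" for \<zeta>
      using norm_square_add_le[OF t, of "u \<zeta>" "v \<zeta>"] by simp
  qed
  also have "\<dots> = (1 + t) * poisson_integral (\<lambda>\<zeta>. (norm (u \<zeta>))\<^sup>2) z
      + (1 + 1 / t) * poisson_integral (\<lambda>\<zeta>. (norm (v \<zeta>))\<^sup>2) z"
    unfolding poisson_integral_add[OF z iu iv] poisson_integral_scaleR by simp
  also have "poisson_integral (\<lambda>\<zeta>. (norm (u \<zeta>))\<^sup>2) z = garsia_Phi f z"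
    unfolding garsia_Phi_alt[OF z f] u_def by simp
  also have "poisson_integral (\<lambda>\<zeta>. (norm (v \<zeta>))\<^sup>2) z = garsia_Phi g z"
    unfolding garsia_Phi_alt[OF z g] v_def by simp
  finally show "garsia_Phi (\<lambda>\<zeta>. f \<zeta> + g \<zeta>) z
      \<le> (1 + t) * garsia_Phi f z + (1 + 1 / t) * garsia_Phi g z" .
qed

lemma garsia_Phi_0_imp_const:
  assumes f: "f \<in> L2_circle" and 0: "garsia_Phi f 0 = 0"
  shows "AE \<zeta> in circle_measure. f \<zeta> = poisson_integral f 0"
proof -
  define c where "c = poisson_integral f 0"
  have "(\<lambda>\<zeta>. f \<zeta> + (- c)) \<in> L2_circle"
    by (intro L2_circle_add L2_circle_const f)
  from L2_circle_square[OF this]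
  have i: "integrable circle_measure (\<lambda>\<zeta>. (norm (f \<zeta> - c))\<^sup>2)" by simp
  have "integral\<^sup>L circle_measure (\<lambda>\<zeta>. (norm (f \<zeta> - c))\<^sup>2)
      = poisson_integral (\<lambda>\<zeta>. (norm (f \<zeta> - c))\<^sup>2) 0"
    unfolding poisson_integral_def
    by (rule Bochner_Integration.integral_cong) (auto simp: poisson_kernel_def)
  also have "\<dots> = 0"
    using garsia_Phi_alt[of 0 f] f 0 by (simp add: c_def)
  finally have "AE \<zeta> in circle_measure. (norm (f \<zeta> - c))\<^sup>2 = 0"
    using integral_nonneg_eq_0_iff_AE[OF i] by simp
  then show ?thesis by (simp add: c_def)
qed

definition garsia_real :: "(complex \<Rightarrow> complex) \<Rightarrow> real" where
  "garsia_real f = real_of_ereal (garsia_norm f)"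

lemma garsia_norm_nonneg:
  assumes "f \<in> L2_circle"
  shows "0 \<le> garsia_norm f"
proof -
  have "0 \<le> ereal (sqrt (garsia_Phi f 0))"
    using garsia_Phi_nonneg[of 0 f] assms by simp
  also have "\<dots> \<le> garsia_norm f"
    unfolding garsia_norm_def by (intro SUP_upper) simp
  finally show ?thesis .
qed

lemma garsia_norm_eq_real: "f \<in> BMO_fun \<Longrightarrow> garsia_norm f = ereal (garsia_real f)"
  using garsia_norm_nonneg[of f] by (auto simp: BMO_fun_def garsia_real_def ereal_real)

lemma garsia_real_nonneg: "f \<in> BMO_fun \<Longrightarrow> 0 \<le> garsia_real f"
  using garsia_norm_nonneg[of f] by (simp add: BMO_fun_def garsia_real_def real_of_ereal_pos)

lemma garsia_real_upper:
  assumes "f \<in> BMO_fun" "z \<in> ball 0 1"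
  shows "sqrt (garsia_Phi f z) \<le> garsia_real f"
proof -
  have "ereal (sqrt (garsia_Phi f z)) \<le> garsia_norm f"
    unfolding garsia_norm_def using assms(2) by (rule SUP_upper)
  then show ?thesis using garsia_norm_eq_real[OF assms(1)] by simp
qed

lemma BMO_funI:
  assumes "f \<in> L2_circle" "\<And>z. z \<in> ball 0 1 \<Longrightarrow> sqrt (garsia_Phi f z) \<le> B"
  shows "f \<in> BMO_fun" and "garsia_real f \<le> B"
proof -
  have le: "garsia_norm f \<le> ereal B"
    unfolding garsia_norm_def using assms(2) by (intro SUP_least) simp
  then show f: "f \<in> BMO_fun"
    using assms(1) by (auto simp: BMO_fun_def intro: le_less_trans)
  show "garsia_real f \<le> B"
    using le garsia_norm_eq_real[OF f] by simp
qed

lemma BMO_fun_L2: "f \<in> BMO_fun \<Longrightarrow> f \<in> L2_circle"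
  by (simp add: BMO_fun_def)

lemma BMO_fun_const: "(\<lambda>_. c) \<in> BMO_fun" and garsia_real_const: "garsia_real (\<lambda>_. c) = 0"
proof -
  have *: "sqrt (garsia_Phi (\<lambda>_. c) z) \<le> 0" if "z \<in> ball 0 1" for z
    using that by (simp add: garsia_Phi_def poisson_integral_const)
  show "(\<lambda>_. c) \<in> BMO_fun"
    by (rule BMO_funI(1)[OF L2_circle_const *])
  then show "garsia_real (\<lambda>_. c) = 0"
    using BMO_funI(2)[OF L2_circle_const *] garsia_real_nonneg by (simp add: order_antisym)
qed

lemma BMO_fun_add:
  assumes f: "f \<in> BMO_fun" and g: "g \<in> BMO_fun"
  shows "(\<lambda>\<zeta>. f \<zeta> + g \<zeta>) \<in> BMO_fun"
    and garsia_real_add: "garsia_real (\<lambda>\<zeta>. f \<zeta> + g \<zeta>) \<le> garsia_real f + garsia_real g"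
proof -
  have *: "sqrt (garsia_Phi (\<lambda>\<zeta>. f \<zeta> + g \<zeta>) z) \<le> garsia_real f + garsia_real g"
    if z: "z \<in> ball 0 1" for z
    using garsia_Phi_triangle[OF z BMO_fun_L2[OF f] BMO_fun_L2[OF g]]
      garsia_real_upper[OF f z] garsia_real_upper[OF g z] by linarith
  note L2 = L2_circle_add[OF BMO_fun_L2[OF f] BMO_fun_L2[OF g]]
  show "(\<lambda>\<zeta>. f \<zeta> + g \<zeta>) \<in> BMO_fun"
    "garsia_real (\<lambda>\<zeta>. f \<zeta> + g \<zeta>) \<le> garsia_real f + garsia_real g"
    using BMO_funI[OF L2 *] by auto
qed

lemma BMO_fun_scaleR:
  assumes f: "f \<in> BMO_fun"
  shows "(\<lambda>\<zeta>. r *\<^sub>R f \<zeta>) \<in> BMO_fun"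
    and garsia_real_scaleR_le: "garsia_real (\<lambda>\<zeta>. r *\<^sub>R f \<zeta>) \<le> \<bar>r\<bar> * garsia_real f"
proof -
  have *: "sqrt (garsia_Phi (\<lambda>\<zeta>. r *\<^sub>R f \<zeta>) z) \<le> \<bar>r\<bar> * garsia_real f" if "z \<in> ball 0 1" for z
    using garsia_real_upper[OF f that]
    by (simp add: garsia_Phi_scaleR real_sqrt_mult mult_left_mono)
  show "(\<lambda>\<zeta>. r *\<^sub>R f \<zeta>) \<in> BMO_fun" "garsia_real (\<lambda>\<zeta>. r *\<^sub>R f \<zeta>) \<le> \<bar>r\<bar> * garsia_real f"
    using BMO_funI[OF L2_circle_scaleR[OF BMO_fun_L2[OF f]] *] by auto
qed

lemma garsia_real_scaleR:
  assumes f: "f \<in> BMO_fun"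
  shows "garsia_real (\<lambda>\<zeta>. r *\<^sub>R f \<zeta>) = \<bar>r\<bar> * garsia_real f"
proof (cases "r = 0")
  case True
  then show ?thesis by (simp add: garsia_real_const)
next
  case False
  have "garsia_real (\<lambda>\<zeta>. inverse r *\<^sub>R (r *\<^sub>R f \<zeta>)) \<le> \<bar>inverse r\<bar> * garsia_real (\<lambda>\<zeta>. r *\<^sub>R f \<zeta>)"
    by (intro garsia_real_scaleR_le BMO_fun_scaleR f)
  then have "\<bar>r\<bar> * garsia_real f \<le> garsia_real (\<lambda>\<zeta>. r *\<^sub>R f \<zeta>)"
    using False by (simp add: field_simps abs_inverse)
  then show ?thesis
    using garsia_real_scaleR_le[OF f, of r] by simp
qed

(* f and g define the same coset modulo constants; as elements of L^2 are classes of functions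
   modulo null sets, the difference is only required to be constant almost everywhere. *)
definition BMO_rel :: "(complex \<Rightarrow> complex) \<Rightarrow> (complex \<Rightarrow> complex) \<Rightarrow> bool" where
  "BMO_rel f g \<longleftrightarrow> f \<in> BMO_fun \<and> g \<in> BMO_fun \<and>
     (\<exists>c. AE \<zeta> in circle_measure. f \<zeta> = g \<zeta> + c)"

lemma BMO_rel_refl: "BMO_rel f f \<longleftrightarrow> f \<in> BMO_fun"
  unfolding BMO_rel_def by (auto intro!: exI[of _ 0])

lemma part_equivp_BMO_rel: "part_equivp BMO_rel"
proof (rule part_equivpI)
  show "\<exists>f. BMO_rel f f"
    using BMO_rel_refl BMO_fun_const by blast
  show "symp BMO_rel"
  proof (rule sympI)
    fix f g assume "BMO_rel f g"
    then obtain c where "f \<in> BMO_fun" "g \<in> BMO_fun" "AE \<zeta> in circle_measure. f \<zeta> = g \<zeta> + c"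
      by (auto simp: BMO_rel_def)
    moreover from this(3) have "AE \<zeta> in circle_measure. g \<zeta> = f \<zeta> + (- c)"
      by eventually_elim simp
    ultimately show "BMO_rel g f" by (auto simp: BMO_rel_def simp del: add_uminus_conv_diff)
  qed
  show "transp BMO_rel"
  proof (rule transpI)
    fix f g h assume "BMO_rel f g" "BMO_rel g h"
    then obtain c d where "f \<in> BMO_fun" "h \<in> BMO_fun" "AE \<zeta> in circle_measure. f \<zeta> = g \<zeta> + c"
      "AE \<zeta> in circle_measure. g \<zeta> = h \<zeta> + d"
      by (auto simp: BMO_rel_def)
    moreover from this(3,4) have "AE \<zeta> in circle_measure. f \<zeta> = h \<zeta> + (d + c)"
      by eventually_elim simp
    ultimately show "BMO_rel f h" by (auto simp: BMO_rel_def)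
  qed
qed

lemma garsia_real_cong:
  assumes "BMO_rel f g"
  shows "garsia_real f = garsia_real g"
proof -
  obtain c where c: "f \<in> BMO_fun" "g \<in> BMO_fun" "AE \<zeta> in circle_measure. f \<zeta> = g \<zeta> + c"
    using assms by (auto simp: BMO_rel_def)
  have "garsia_norm f = garsia_norm g"
    unfolding garsia_norm_def
    using garsia_Phi_cong[OF _ BMO_fun_L2[OF c(1)] BMO_fun_L2[OF c(2)] c(3)]
    by (intro SUP_cong) auto
  then show ?thesis by (simp add: garsia_real_def)
qed

lemma BMO_rel_add:
  assumes "BMO_rel f f'" "BMO_rel g g'"
  shows "BMO_rel (\<lambda>\<zeta>. f \<zeta> + g \<zeta>) (\<lambda>\<zeta>. f' \<zeta> + g' \<zeta>)"
proof -
  obtain c d where "AE \<zeta> in circle_measure. f \<zeta> = f' \<zeta> + c"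
    "AE \<zeta> in circle_measure. g \<zeta> = g' \<zeta> + d"
    using assms by (auto simp: BMO_rel_def)
  then have "AE \<zeta> in circle_measure. f \<zeta> + g \<zeta> = f' \<zeta> + g' \<zeta> + (c + d)"
    by eventually_elim simp
  then show ?thesis
    using assms BMO_fun_add(1) by (auto simp: BMO_rel_def)
qed

lemma BMO_rel_scaleR:
  assumes "BMO_rel f g"
  shows "BMO_rel (\<lambda>\<zeta>. r *\<^sub>R f \<zeta>) (\<lambda>\<zeta>. r *\<^sub>R g \<zeta>)"
proof -
  obtain c where "AE \<zeta> in circle_measure. f \<zeta> = g \<zeta> + c"
    using assms by (auto simp: BMO_rel_def)
  then have "AE \<zeta> in circle_measure. r *\<^sub>R f \<zeta> = r *\<^sub>R g \<zeta> + r *\<^sub>R c"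
    by eventually_elim (simp add: scaleR_add_right)
  then show ?thesis
    using assms BMO_fun_scaleR(1) by (auto simp: BMO_rel_def)
qed

(* For f in BMO_fun, BMO_coset f is the coset f + C. Only the real scalar multiplication is
   provided (the library has no class of complex normed spaces); it suffices for extreme points. *)
quotient_type BMO = "complex \<Rightarrow> complex" / partial: BMO_rel
  morphisms rep_BMO BMO_coset
  by (rule part_equivp_BMO_rel)

instantiation BMO :: real_normed_vector
begin

lift_definition zero_BMO :: BMO is "\<lambda>_. 0"
  by (simp add: BMO_rel_refl BMO_fun_const)

lift_definition plus_BMO :: "BMO \<Rightarrow> BMO \<Rightarrow> BMO" is "\<lambda>f g \<zeta>. f \<zeta> + g \<zeta>"
  by (rule BMO_rel_add)

lift_definition scaleR_BMO :: "real \<Rightarrow> BMO \<Rightarrow> BMO" is "\<lambda>r f \<zeta>. r *\<^sub>R f \<zeta>"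
  by (rule BMO_rel_scaleR)

definition uminus_BMO :: "BMO \<Rightarrow> BMO" where "uminus_BMO x = (-1) *\<^sub>R x"

definition minus_BMO :: "BMO \<Rightarrow> BMO \<Rightarrow> BMO" where "minus_BMO x y = x + (- y)"

lift_definition norm_BMO :: "BMO \<Rightarrow> real" is "\<lambda>f. real_of_ereal (garsia_norm f)"
  using garsia_real_cong by (simp add: garsia_real_def)

definition sgn_BMO :: "BMO \<Rightarrow> BMO" where "sgn_BMO x = inverse (norm x) *\<^sub>R x"

definition dist_BMO :: "BMO \<Rightarrow> BMO \<Rightarrow> real" where "dist_BMO x y = norm (x - y)"

definition uniformity_BMO :: "(BMO \<times> BMO) filter" where
  "uniformity_BMO = (INF e\<in>{0<..}. principal {(x, y). dist x y < e})"

definition open_BMO :: "BMO set \<Rightarrow> bool" where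
  "open_BMO U \<longleftrightarrow> (\<forall>x\<in>U. eventually (\<lambda>(x', y). x' = x \<longrightarrow> y \<in> U) uniformity)"

instance
proof
  fix x y w :: BMO and r s :: real
  show "x + y + w = x + (y + w)"
    by transfer (simp add: add.assoc BMO_rel_refl BMO_fun_add(1))
  show "x + y = y + x"
    by transfer (simp add: add.commute BMO_rel_refl BMO_fun_add(1))
  show "0 + x = x"
    by transfer (simp add: BMO_rel_refl)
  show "- x + x = 0"
    unfolding uminus_BMO_def by transfer (simp add: BMO_rel_refl BMO_fun_const)
  show "x - y = x + - y"
    by (rule minus_BMO_def)
  show "r *\<^sub>R (x + y) = r *\<^sub>R x + r *\<^sub>R y"
    by transfer (simp add: scaleR_add_right BMO_rel_refl BMO_fun_add(1) BMO_fun_scaleR(1))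
  show "(r + s) *\<^sub>R x = r *\<^sub>R x + s *\<^sub>R x"
    by transfer (simp add: scaleR_add_left BMO_rel_refl BMO_fun_add(1) BMO_fun_scaleR(1))
  show "r *\<^sub>R s *\<^sub>R x = (r * s) *\<^sub>R x"
    by transfer (simp add: BMO_rel_refl BMO_fun_scaleR(1))
  show "1 *\<^sub>R x = x"
    by transfer (simp add: BMO_rel_refl)
  show "dist x y = norm (x - y)" by (rule dist_BMO_def)
  show "sgn x = inverse (norm x) *\<^sub>R x" by (rule sgn_BMO_def)
  show "uniformity = (INF e\<in>{0<..}. principal {(x, y :: BMO). dist x y < e})"
    by (rule uniformity_BMO_def)
  show "open U \<longleftrightarrow> (\<forall>x\<in>U. \<forall>\<^sub>F (x', y) in uniformity. x' = x \<longrightarrow> y \<in> U)" for U :: "BMO set"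
    by (rule open_BMO_def)
  show "norm x = 0 \<longleftrightarrow> x = 0"
  proof transfer
    fix f assume "BMO_rel f f"
    then have f: "f \<in> BMO_fun" by (simp add: BMO_rel_refl)
    show "real_of_ereal (garsia_norm f) = 0 \<longleftrightarrow> BMO_rel f (\<lambda>_. 0)"
    proof
      assume "real_of_ereal (garsia_norm f) = 0"
      then have "sqrt (garsia_Phi f 0) \<le> 0"
        using garsia_real_upper[OF f, of 0] by (simp add: garsia_real_def)
      then have "garsia_Phi f 0 = 0"
        using garsia_Phi_nonneg[of 0 f] BMO_fun_L2[OF f] by simp
      then have "AE \<zeta> in circle_measure. f \<zeta> = poisson_integral f 0"
        by (rule garsia_Phi_0_imp_const[OF BMO_fun_L2[OF f]])
      then show "BMO_rel f (\<lambda>_. 0)"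
        using f by (auto simp: BMO_rel_def BMO_fun_const)
    next
      assume "BMO_rel f (\<lambda>_. 0)"
      from garsia_real_cong[OF this] show "real_of_ereal (garsia_norm f) = 0"
        using garsia_real_const[of 0] by (simp add: garsia_real_def)
    qed
  qed
  show "norm (x + y) \<le> norm x + norm y"
    by transfer (use garsia_real_add in \<open>simp add: garsia_real_def BMO_rel_refl\<close>)
  show "norm (r *\<^sub>R x) = \<bar>r\<bar> * norm x"
    by transfer (use garsia_real_scaleR in \<open>simp add: garsia_real_def BMO_rel_refl\<close>)
qed

end

(* The library's extreme points, defined through open segments, are for convex sets the same
   as those defined through midpoints. *)
lemma extreme_point_of_iff_midpoint:
  fixes x :: "'a::real_vector"
  assumes S: "convex S"
  shows "x extreme_point_of S \<longleftrightarrow>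
    x \<in> S \<and> \<not> (\<exists>u\<in>S. \<exists>v\<in>S. u \<noteq> v \<and> x = (1/2) *\<^sub>R (u + v))"
proof (intro iffI conjI notI)
  assume x: "x extreme_point_of S"
  then show "x \<in> S" by (simp add: extreme_point_of_def)
  assume "\<exists>u\<in>S. \<exists>v\<in>S. u \<noteq> v \<and> x = (1/2) *\<^sub>R (u + v)"
  then obtain u v where uv: "u \<in> S" "v \<in> S" "u \<noteq> v" "x = (1/2) *\<^sub>R (u + v)" by blast
  have "x \<in> open_segment u v"
    unfolding in_segment using uv(3,4)
    by (intro conjI exI[of _ "1/2"]) (auto simp: scaleR_add_right)
  with x uv show False by (auto simp: extreme_point_of_def)
next
  assume x: "x \<in> S \<and> \<not> (\<exists>u\<in>S. \<exists>v\<in>S. u \<noteq> v \<and> x = (1/2) *\<^sub>R (u + v))"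
  show "x extreme_point_of S"
    unfolding extreme_point_of_def
  proof (intro conjI ballI notI)
    show "x \<in> S" using x by blast
    fix a b assume ab: "a \<in> S" "b \<in> S" and "x \<in> open_segment a b"
    then obtain t where t: "a \<noteq> b" "0 < t" "t < 1" "x = (1 - t) *\<^sub>R a + t *\<^sub>R b"
      by (auto simp: in_segment)
    define d where "d = min t (1 - t)"
    have d: "0 < d" "d \<le> t" "d \<le> 1 - t" using t by (auto simp: d_def)
    define u where "u = x - d *\<^sub>R (b - a)"
    define v where "v = x + d *\<^sub>R (b - a)"
    have "u = (1 - (t - d)) *\<^sub>R a + (t - d) *\<^sub>R b"
      "v = (1 - (t + d)) *\<^sub>R a + (t + d) *\<^sub>R b"
      by (simp_all add: u_def v_def t(4) algebra_simps)
    then have "u \<in> S" "v \<in> S"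
      using d ab t(2,3) by (auto intro!: convexD[OF S])
    moreover have "u \<noteq> v"
    proof
      assume "u = v"
      then have "d *\<^sub>R (b - a) = - (d *\<^sub>R (b - a))"
        unfolding u_def v_def by (metis add_left_cancel diff_conv_add_uminus)
      then have "2 *\<^sub>R (d *\<^sub>R (b - a)) = 0"
        unfolding scaleR_2 by (metis add.right_inverse)
      then show False using d t(1) by simp
    qed
    moreover have "u + v = 2 *\<^sub>R x"
      by (simp add: u_def v_def scaleR_2)
    then have "x = (1/2) *\<^sub>R (u + v)" by simp
    ultimately show False using x by blast
  qed
qed

end

theory Submission
  imports Defs
begin

text \<open>
  For a fixed point \<open>z\<close> of the disc, \<open>garsia_Phi f z\<close> is the variance of \<open>f\<close> with respect to the
  probability measure with density \<open>poisson_kernel z\<close>. It is therefore the square of a Hilbert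
  seminorm, and obeys the parallelogram law (\<open>garsia_Phi_parallelogram\<close>). A supremum of such
  seminorms need not inherit their strict convexity, but it does so at an \<open>f\<close> for which the
  supremum is attained.

  To see this, let the Garsia norm of \<open>f\<close> be 1 and be attained at \<open>z0\<close>, and let \<open>f\<close> be the midpoint
  of \<open>f + g\<close> and \<open>f - g\<close> in the unit ball. At \<open>z0\<close> the variances of \<open>f + g\<close> and \<open>f - g\<close> are at
  most 1 and that of \<open>f\<close> is exactly 1, so the parallelogram law leaves no room for a positive
  variance of \<open>g\<close>. As the Poisson kernel is strictly positive on the circle, \<open>g\<close> is constant almost
  everywhere (\<open>garsia_Phi_eq_0_imp_const\<close>), that is, \<open>g\<close> is 0 modulo constants.
\<close>

text \<open>Both terms of \<open>garsia_Phi\<close> are squared Euclidean norms, the first one after averaging,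
  so each of them satisfies the parallelogram law of the complex plane.\<close>

lemma garsia_Phi_parallelogram:
  assumes z: "z \<in> ball 0 1" and f: "f \<in> L2_circle" and g: "g \<in> L2_circle"
  shows "garsia_Phi (\<lambda>\<zeta>. f \<zeta> + g \<zeta>) z + garsia_Phi (\<lambda>\<zeta>. f \<zeta> - g \<zeta>) z
    = 2 * garsia_Phi f z + 2 * garsia_Phi g z"
proof -
  have parallelogram: "(norm (a + b))\<^sup>2 + (norm (a - b))\<^sup>2 = 2 *\<^sub>R (norm a)\<^sup>2 + 2 *\<^sub>R (norm b)\<^sup>2"
    for a b :: complex
    by (simp add: power2_norm_eq_inner inner_add_left inner_add_right inner_diff_left
        inner_diff_right inner_commute)
  have g': "(\<lambda>\<zeta>. - g \<zeta>) \<in> L2_circle"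
    using L2_circle_scaleR[OF g, of "-1"] by simp
  have sq_add: "integrable circle_measure (\<lambda>\<zeta>. (norm (f \<zeta> + g \<zeta>))\<^sup>2)"
    and sq_diff: "integrable circle_measure (\<lambda>\<zeta>. (norm (f \<zeta> - g \<zeta>))\<^sup>2)"
    using L2_circle_square[OF L2_circle_add[OF f g]] L2_circle_square[OF L2_circle_add[OF f g']]
    by simp_all
  have "poisson_integral (\<lambda>\<zeta>. (norm (f \<zeta> + g \<zeta>))\<^sup>2) z + poisson_integral (\<lambda>\<zeta>. (norm (f \<zeta> - g \<zeta>))\<^sup>2) z
      = poisson_integral (\<lambda>\<zeta>. 2 *\<^sub>R (norm (f \<zeta>))\<^sup>2 + 2 *\<^sub>R (norm (g \<zeta>))\<^sup>2) z"
    by (simp only: poisson_integral_add[OF z sq_add sq_diff, symmetric] parallelogram)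
  also have "\<dots> = 2 * poisson_integral (\<lambda>\<zeta>. (norm (f \<zeta>))\<^sup>2) z
      + 2 * poisson_integral (\<lambda>\<zeta>. (norm (g \<zeta>))\<^sup>2) z"
    using L2_circle_square[OF f] L2_circle_square[OF g]
    unfolding real_scaleR_def[symmetric]
    by (subst poisson_integral_add[OF z])
       (auto simp only: poisson_integral_scaleR intro: integrable_scaleR_right)
  finally have squares: "poisson_integral (\<lambda>\<zeta>. (norm (f \<zeta> + g \<zeta>))\<^sup>2) z
      + poisson_integral (\<lambda>\<zeta>. (norm (f \<zeta> - g \<zeta>))\<^sup>2) z
    = 2 * poisson_integral (\<lambda>\<zeta>. (norm (f \<zeta>))\<^sup>2) z + 2 * poisson_integral (\<lambda>\<zeta>. (norm (g \<zeta>))\<^sup>2) z" .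
  have "poisson_integral (\<lambda>\<zeta>. f \<zeta> + g \<zeta>) z = poisson_integral f z + poisson_integral g z"
    using z f g by (intro poisson_integral_add L2_circle_integrable)
  moreover have "poisson_integral (\<lambda>\<zeta>. f \<zeta> - g \<zeta>) z = poisson_integral f z - poisson_integral g z"
    using poisson_integral_add[OF z L2_circle_integrable[OF f] L2_circle_integrable[OF g']]
      poisson_integral_scaleR[of "-1" g z] by simp
  ultimately show ?thesis
    using squares parallelogram[of "poisson_integral f z" "poisson_integral g z"]
    unfolding garsia_Phi_def by simp
qed

lemma poisson_kernel_pos:
  assumes "z \<in> ball 0 1" "\<zeta> \<in> sphere 0 1"
  shows "0 < poisson_kernel z \<zeta>"
proof -
  have "\<zeta> \<noteq> z" using assms by auto
  moreover have "(norm z)\<^sup>2 < 1" using assms by (simp add: power_less_one_iff abs_square_less_1)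
  ultimately show ?thesis by (simp add: poisson_kernel_def)
qed

text \<open>The measure with density \<open>poisson_kernel z\<close> has the same null sets as arc length, so a
  vanishing variance at any one point of the disc already forces the function to be constant.\<close>

lemma garsia_Phi_eq_0_imp_const:
  assumes z: "z \<in> ball 0 1" and f: "f \<in> L2_circle" and 0: "garsia_Phi f z = 0"
  shows "AE \<zeta> in circle_measure. f \<zeta> = poisson_integral f z"
proof -
  define c where "c = poisson_integral f z"
  have "(\<lambda>\<zeta>. f \<zeta> + (- c)) \<in> L2_circle"
    by (intro L2_circle_add L2_circle_const f)
  from poisson_integrable[OF z L2_circle_square[OF this]]
  have i: "integrable circle_measure (\<lambda>\<zeta>. poisson_kernel z \<zeta> *\<^sub>R (norm (f \<zeta> - c))\<^sup>2)" by simp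
  have "integral\<^sup>L circle_measure (\<lambda>\<zeta>. poisson_kernel z \<zeta> *\<^sub>R (norm (f \<zeta> - c))\<^sup>2) = 0"
    using garsia_Phi_alt[OF z f] 0 by (simp add: c_def poisson_integral_def)
  then have "AE \<zeta> in circle_measure. poisson_kernel z \<zeta> *\<^sub>R (norm (f \<zeta> - c))\<^sup>2 = 0"
    using integral_nonneg_eq_0_iff_AE[OF i] poisson_kernel_nonneg[OF z] by simp
  then show ?thesis
    using AE_space
  proof eventually_elim
    case (elim \<zeta>)
    then show ?case
      using poisson_kernel_pos[OF z, of \<zeta>] by (simp add: c_def)
  qed
qed

text \<open>Strict convexity of the Garsia norm at a function which attains it.\<close>

lemma garsia_attained_perturbation_const:
  assumes z: "z \<in> ball 0 1" and f: "f \<in> BMO_fun" and g: "g \<in> BMO_fun"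
    and attained: "garsia_Phi f z = 1"
    and add: "garsia_real (\<lambda>\<zeta>. f \<zeta> + g \<zeta>) \<le> 1" and diff: "garsia_real (\<lambda>\<zeta>. f \<zeta> - g \<zeta>) \<le> 1"
  shows "BMO_rel g (\<lambda>_. 0)"
proof -
  note L2 = BMO_fun_L2[OF f] BMO_fun_L2[OF g]
  have "(\<lambda>\<zeta>. f \<zeta> - g \<zeta>) \<in> BMO_fun"
    using BMO_fun_add(1)[OF f BMO_fun_scaleR(1)[OF g, of "-1"]] by simp
  then have "sqrt (garsia_Phi (\<lambda>\<zeta>. f \<zeta> - g \<zeta>) z) \<le> 1"
    using diff by (blast intro: order_trans garsia_real_upper[OF _ z])
  moreover have "sqrt (garsia_Phi (\<lambda>\<zeta>. f \<zeta> + g \<zeta>) z) \<le> 1"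
    using garsia_real_upper[OF BMO_fun_add(1)[OF f g] z] add by (rule order_trans)
  ultimately have "garsia_Phi g z \<le> 0"
    using garsia_Phi_parallelogram[OF z L2] attained by simp
  then have "garsia_Phi g z = 0"
    using garsia_Phi_nonneg[OF z L2(2)] by simp
  then have "AE \<zeta> in circle_measure. g \<zeta> = 0 + poisson_integral g z"
    using garsia_Phi_eq_0_imp_const[OF z L2(2)] by simp
  then show ?thesis
    using g BMO_fun_const unfolding BMO_rel_def by blast
qed

lemma norm_BMO_coset: "f \<in> BMO_fun \<Longrightarrow> norm (BMO_coset f) = garsia_real f"
  by (simp add: norm_BMO.abs_eq BMO_rel_refl garsia_real_def)

lemma BMO_coset_add:
  "f \<in> BMO_fun \<Longrightarrow> g \<in> BMO_fun \<Longrightarrow> BMO_coset f + BMO_coset g = BMO_coset (\<lambda>\<zeta>. f \<zeta> + g \<zeta>)"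
  by (simp add: plus_BMO.abs_eq BMO_rel_refl)

lemma BMO_coset_diff:
  assumes "f \<in> BMO_fun" "g \<in> BMO_fun"
  shows "BMO_coset f - BMO_coset g = BMO_coset (\<lambda>\<zeta>. f \<zeta> - g \<zeta>)"
proof -
  have "- BMO_coset g = BMO_coset (\<lambda>\<zeta>. (-1) *\<^sub>R g \<zeta>)"
    unfolding uminus_BMO_def by (rule scaleR_BMO.abs_eq) (simp add: BMO_rel_refl assms)
  then show ?thesis
    using BMO_coset_add[OF assms(1) BMO_fun_scaleR(1)[OF assms(2), of "-1"]]
    unfolding minus_BMO_def by simp
qed

lemma BMO_coset_cases:
  obtains f where "f \<in> BMO_fun" "x = BMO_coset f"
  by (induction x rule: BMO.abs_induct) (auto simp: BMO_rel_refl)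

theorem theorem2p7:
  fixes f :: "complex \<Rightarrow> complex"
  assumes "f \<in> BMO_na" and "garsia_norm f = 1"
  shows "BMO_coset f extreme_point_of cball 0 1"
proof -
  obtain z0 where f: "f \<in> BMO_fun" and z0: "z0 \<in> ball 0 1" and "garsia_Phi f z0 = 1"
    using assms by (auto simp: BMO_na_def one_ereal_def)
  have norm_f: "norm (BMO_coset f) = 1"
    using assms(2) by (simp add: norm_BMO_coset[OF f] garsia_real_def)
  have "u = v" if u: "norm u \<le> 1" and v: "norm v \<le> 1" and mid: "BMO_coset f = (1/2) *\<^sub>R (u + v)"
    for u v
  proof -
    obtain g where g: "g \<in> BMO_fun" and h: "(1/2) *\<^sub>R (u - v) = BMO_coset g"
      by (rule BMO_coset_cases)
    have half: "(1/2) *\<^sub>R w + (1/2) *\<^sub>R w = w" for w :: BMO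
      using scaleR_add_left[of "1/2" "1/2" w] by simp
    have "u = BMO_coset f + BMO_coset g" "v = BMO_coset f - BMO_coset g"
      using half[of u] half[of v] unfolding mid h[symmetric]
      by (simp_all add: scaleR_add_right scaleR_diff_right)
    then have uv: "u = BMO_coset (\<lambda>\<zeta>. f \<zeta> + g \<zeta>)" "v = BMO_coset (\<lambda>\<zeta>. f \<zeta> - g \<zeta>)"
      by (simp_all add: BMO_coset_add BMO_coset_diff f g)
    have "(\<lambda>\<zeta>. f \<zeta> - g \<zeta>) \<in> BMO_fun"
      using BMO_fun_add(1)[OF f BMO_fun_scaleR(1)[OF g, of "-1"]] by simp
    then have "BMO_rel g (\<lambda>_. 0)"
      using u v \<open>garsia_Phi f z0 = 1\<close> unfolding uv
      by (intro garsia_attained_perturbation_const[OF z0 f g])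
         (simp_all add: norm_BMO_coset BMO_fun_add(1) f g)
    then have "BMO_coset g = 0"
      unfolding zero_BMO_def by (rule Quotient3_rel_abs[OF Quotient3_BMO])
    then show "u = v" using h by simp
  qed
  then show ?thesis
    unfolding extreme_point_of_iff_midpoint[OF convex_cball]
    using norm_f by auto
qed

end
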